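(* For every premetric space $(X,d)$, the premetric space $(\widehat{X},\widehat{d})$ is complete. Consequently every premetric space $X$ admits a completion, and the completion is unique up to isometry: if $Y$ is a complete premetric space and $h:X\to Y$ is an isometric embedding with dense image, then there is an isometry (bijective isometric embedding) between $Y$ and $\widehat{X}$.
   Context: A premetric on a nonempty set $X$ is a relation $d$ between $X\times X$ and the nonnegative rationals, written $d(x,y)\leq q$, such that for all $x,y,z\in X$ and nonnegative rationals $p,q$: (1) $d(x,y)\leq 0$ iff $x=y$; (2) $d(x,y)\leq q$ implies $d(y,x)\leq q$; (3) $d(x,z)\leq p$ and $d(z,y)\leq q$ imply $d(x,y)\leq p+q$; (4) $d(x,y)\leq p$ iff $d(x,y)\leq q$ for all rationals $q>p$. For $S\subseteq X$, $\operatorname{diam} S\leq q$ means $d(x,y)\leq q$ for all $x,y\in S$. A Cauchy family on $X$ is $F\subseteq\mathcal{P}(X)$ with (i) $S\cap T\neq\emptyset$ for all $S,T\in F$ and (ii) for every rational $\varepsilon>0$ some $S\in F$ has $\operatorname{diam} S\leq\varepsilon$. For Cauchy families $F,F'$, $d(F,F')\leq q$ means: for every rational $\varepsilon>0$ there exist $S\in F$, $T\in F'$ with $\operatorname{diam} S,\operatorname{diam} T\leq\varepsilon$ and $\operatorname{diam}(S\cup T)\leq q+\varepsilon$. This is a pseudo-premetric; $F\sim F'$ iff $d(F,F')\leq 0$ is an equivalence relation; $\widehat{X}$ is the set of classes $[F]$ with premetric $\widehat{d}([F],[F'])\leq q$ iff $d(F,F')\leq q$. A premetric space $X$ is complete if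 the map $i:X\to\widehat{X}$, $i(x)=$ class of $\{\{x\}\}$, is onto. A map $f:(X,d_X)\to(Y,d_Y)$ is an isometric embedding if $d_X(x,x')\leq q\iff d_Y(f(x),f(x'))\leq q$ for all $x,x'$ and nonnegative rationals $q$; an isometry is an onto isometric embedding. $D\subseteq Y$ is dense if for every rational $\varepsilon>0$ and $y\in Y$ there is $z\in D$ with $d_Y(z,y)\leq\varepsilon$. A completion of $X$ is a complete premetric space $Y$ together with an isometric embedding $X\to Y$ with dense image. *)

theory Defs
  imports Complex_Main
begin

text \<open>
  A premetric is a relation: \<open>d x y q\<close> stands for \<open>d(x,y) \<le> q\<close>.  Only the values of \<open>d\<close> at points
  of the carrier \<open>X\<close> and at rationals \<open>q \<ge> 0\<close> are meaningful.  No rational bound on the distance of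
  two given points has to exist.
\<close>

type_synonym 'a dist_rel = "'a \<Rightarrow> 'a \<Rightarrow> rat \<Rightarrow> bool"

definition premetric :: "'a set \<Rightarrow> 'a dist_rel \<Rightarrow> bool" where
  "premetric X d \<longleftrightarrow>
     X \<noteq> {} \<and>
     (\<forall>x\<in>X. \<forall>y\<in>X. d x y 0 \<longleftrightarrow> x = y) \<and>
     (\<forall>x\<in>X. \<forall>y\<in>X. \<forall>q\<ge>0. d x y q \<longrightarrow> d y x q) \<and>
     (\<forall>x\<in>X. \<forall>y\<in>X. \<forall>z\<in>X. \<forall>p\<ge>0. \<forall>q\<ge>0. d x z p \<and> d z y q \<longrightarrow> d x y (p + q)) \<and>
     (\<forall>x\<in>X. \<forall>y\<in>X. \<forall>p\<ge>0. d x y p \<longleftrightarrow> (\<forall>q>p. d x y q))"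

definition diam_le :: "'a dist_rel \<Rightarrow> 'a set \<Rightarrow> rat \<Rightarrow> bool" where
  "diam_le d S q \<longleftrightarrow> (\<forall>x\<in>S. \<forall>y\<in>S. d x y q)"

definition cauchy_family :: "'a set \<Rightarrow> 'a dist_rel \<Rightarrow> 'a set set \<Rightarrow> bool" where
  "cauchy_family X d F \<longleftrightarrow>
     F \<subseteq> Pow X \<and>
     (\<forall>S\<in>F. \<forall>T\<in>F. S \<inter> T \<noteq> {}) \<and>
     (\<forall>\<epsilon>>0. \<exists>S\<in>F. diam_le d S \<epsilon>)"

definition family_dist :: "'a dist_rel \<Rightarrow> 'a set set dist_rel" where
  "family_dist d F F' q \<longleftrightarrow>
     (\<forall>\<epsilon>>0. \<exists>S\<in>F. \<exists>T\<in>F'.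
        diam_le d S \<epsilon> \<and> diam_le d T \<epsilon> \<and> diam_le d (S \<union> T) (q + \<epsilon>))"

definition family_rel :: "'a set \<Rightarrow> 'a dist_rel \<Rightarrow> ('a set set \<times> 'a set set) set" where
  "family_rel X d =
     {(F, F'). cauchy_family X d F \<and> cauchy_family X d F' \<and> family_dist d F F' 0}"

definition hat_space :: "'a set \<Rightarrow> 'a dist_rel \<Rightarrow> 'a set set set set" where
  "hat_space X d = {F. cauchy_family X d F} // family_rel X d"

text \<open>The choice of representatives is irrelevant, see \<open>hat_dist_class\<close> below.\<close>

definition hat_dist :: "'a dist_rel \<Rightarrow> 'a set set set dist_rel" where
  "hat_dist d A B q \<longleftrightarrow> (\<exists>F\<in>A. \<exists>F'\<in>B. family_dist d F F' q)"

definition hat_emb :: "'a set \<Rightarrow> 'a dist_rel \<Rightarrow> 'a \<Rightarrow> 'a set set set" where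
  "hat_emb X d x = family_rel X d `` {{{x}}}"

definition complete_premetric :: "'a set \<Rightarrow> 'a dist_rel \<Rightarrow> bool" where
  "complete_premetric X d \<longleftrightarrow> premetric X d \<and> hat_emb X d ` X = hat_space X d"

definition isometric_embedding ::
  "'a set \<Rightarrow> 'a dist_rel \<Rightarrow> 'b set \<Rightarrow> 'b dist_rel \<Rightarrow> ('a \<Rightarrow> 'b) \<Rightarrow> bool" where
  "isometric_embedding X dX Y dY f \<longleftrightarrow>
     f ` X \<subseteq> Y \<and> (\<forall>x\<in>X. \<forall>x'\<in>X. \<forall>q\<ge>0. dX x x' q \<longleftrightarrow> dY (f x) (f x') q)"

definition isometry ::
  "'a set \<Rightarrow> 'a dist_rel \<Rightarrow> 'b set \<Rightarrow> 'b dist_rel \<Rightarrow> ('a \<Rightarrow> 'b) \<Rightarrow> bool" where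
  "isometry X dX Y dY f \<longleftrightarrow> isometric_embedding X dX Y dY f \<and> f ` X = Y"

definition dense_subset :: "'a set \<Rightarrow> 'a dist_rel \<Rightarrow> 'a set \<Rightarrow> bool" where
  "dense_subset Y d D \<longleftrightarrow> D \<subseteq> Y \<and> (\<forall>\<epsilon>>0. \<forall>y\<in>Y. \<exists>z\<in>D. d z y \<epsilon>)"

definition is_completion ::
  "'a set \<Rightarrow> 'a dist_rel \<Rightarrow> 'b set \<Rightarrow> 'b dist_rel \<Rightarrow> ('a \<Rightarrow> 'b) \<Rightarrow> bool" where
  "is_completion X dX Y dY h \<longleftrightarrow>
     complete_premetric Y dY \<and> isometric_embedding X dX Y dY h \<and> dense_subset Y dY (h ` X)"

lemma premetric_mono:
  assumes "premetric X d" "x \<in> X" "y \<in> X" "d x y p" "0 \<le> p" "p \<le> q"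
  shows "d x y q"
proof (cases "p = q")
  case False
  then have "p < q" using assms(6) by simp
  then show ?thesis using assms(1-5) unfolding premetric_def by blast
qed (use assms(4) in simp)

lemma family_dist_refl:
  assumes "cauchy_family X d F"
  shows "family_dist d F F 0"
  unfolding family_dist_def
proof (intro allI impI)
  fix e :: rat assume "e > 0"
  then obtain S where "S \<in> F" "diam_le d S e"
    using assms unfolding cauchy_family_def by blast
  then show "\<exists>S\<in>F. \<exists>T\<in>F. diam_le d S e \<and> diam_le d T e \<and> diam_le d (S \<union> T) (0 + e)"
    by (intro bexI[of _ S]) simp_all
qed

lemma family_dist_sym:
  assumes "family_dist d F G q"
  shows "family_dist d G F q"
  using assms unfolding family_dist_def by (metis Un_commute)

lemma family_dist_triangle:
  assumes X: "premetric X d"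
    and F: "cauchy_family X d F" and G: "cauchy_family X d G" and H: "cauchy_family X d H"
    and p: "family_dist d F G p" "0 \<le> p" and q: "family_dist d G H q" "0 \<le> q"
  shows "family_dist d F H (p + q)"
  unfolding family_dist_def
proof (intro allI impI)
  fix e :: rat assume e: "e > 0"
  then have e2: "e / 2 > 0" by simp
  obtain S T where S: "S \<in> F" "T \<in> G" "diam_le d S (e/2)" "diam_le d (S \<union> T) (p + e/2)"
    using p(1) e2 unfolding family_dist_def by blast
  obtain T' U where U: "T' \<in> G" "U \<in> H" "diam_le d U (e/2)" "diam_le d (T' \<union> U) (q + e/2)"
    using q(1) e2 unfolding family_dist_def by blast
  have sub: "S \<subseteq> X" "U \<subseteq> X" "T \<subseteq> X"
    using F G H S U unfolding cauchy_family_def by auto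
  obtain t where t: "t \<in> T" "t \<in> T'"
    using G S(2) U(1) unfolding cauchy_family_def by (meson IntE ex_in_conv)
  have tri: "d x y (a + b)" if "x \<in> X" "y \<in> X" "z \<in> X" "0 \<le> a" "0 \<le> b" "d x z a" "d z y b"
    for x y z a b
    using X that unfolding premetric_def by meson
  have su: "d x y (p + q + e)" if "x \<in> S" "y \<in> U" for x y
  proof -
    have "d x t (p + e/2)" "d t y (q + e/2)"
      using S(4) U(4) t that unfolding diam_le_def by auto
    moreover have "x \<in> X" "y \<in> X" "t \<in> X" "0 \<le> p + e/2" "0 \<le> q + e/2"
      using sub t that p(2) q(2) e by auto
    ultimately have "d x y ((p + e/2) + (q + e/2))" using tri by blast
    then show ?thesis by (simp add: algebra_simps)
  qed
  have us: "d y x (p + q + e)" if "x \<in> S" "y \<in> U" for x y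
  proof -
    have "x \<in> X" "y \<in> X" "0 \<le> p + q + e" using sub that p(2) q(2) e by auto
    then show ?thesis using su[OF that] X unfolding premetric_def by blast
  qed
  have m: "diam_le d W r" if "diam_le d W (e/2)" "W \<subseteq> X" "e/2 \<le> r" for W r
    unfolding diam_le_def
  proof (intro ballI)
    fix x y assume xy: "x \<in> W" "y \<in> W"
    then have "d x y (e/2)" using that(1) unfolding diam_le_def by blast
    then show "d x y r"
      using premetric_mono[OF X, of x y "e/2" r] xy that(2,3) e2 by auto
  qed
  have "diam_le d S e" "diam_le d U e" "diam_le d S (p+q+e)" "diam_le d U (p+q+e)"
    using m[OF S(3) sub(1)] m[OF U(3) sub(2)] e p(2) q(2) by auto
  then show "\<exists>S\<in>F. \<exists>T\<in>H. diam_le d S e \<and> diam_le d T e \<and> diam_le d (S \<union> T) (p + q + e)"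
    using S(1) U(2) su us unfolding diam_le_def
    by (intro bexI[of _ S] bexI[of _ U]) auto
qed

lemma equiv_family_rel:
  assumes "premetric X d"
  shows "equiv {F. cauchy_family X d F} (family_rel X d)"
proof (rule equivI)
  show "family_rel X d \<subseteq> {F. cauchy_family X d F} \<times> {F. cauchy_family X d F}"
    unfolding family_rel_def by auto
  show "refl_on {F. cauchy_family X d F} (family_rel X d)"
    unfolding refl_on_def family_rel_def using family_dist_refl by auto
  show "sym (family_rel X d)"
    unfolding sym_def family_rel_def using family_dist_sym by auto
  show "trans (family_rel X d)"
    unfolding trans_def family_rel_def
    using family_dist_triangle[OF assms, of _ _ _ 0 0] by auto
qed

lemma hat_dist_class:
  assumes X: "premetric X d" and F: "cauchy_family X d F" and G: "cauchy_family X d G"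
    and q: "0 \<le> q"
  shows "hat_dist d (family_rel X d `` {F}) (family_rel X d `` {G}) q \<longleftrightarrow> family_dist d F G q"
proof
  assume "family_dist d F G q"
  then show "hat_dist d (family_rel X d `` {F}) (family_rel X d `` {G}) q"
    using F G family_dist_refl unfolding hat_dist_def family_rel_def by blast
next
  assume "hat_dist d (family_rel X d `` {F}) (family_rel X d `` {G}) q"
  then obtain F' G' where *: "cauchy_family X d F'" "cauchy_family X d G'"
    "family_dist d F F' 0" "family_dist d G G' 0" "family_dist d F' G' q"
    unfolding hat_dist_def family_rel_def by blast
  have "family_dist d F G' (0 + q)"
    using family_dist_triangle[OF X F *(1,2,3) _ *(5)] q by simp
  then have "family_dist d F G (0 + q + 0)"
    using family_dist_triangle[OF X F *(2) G _ _ family_dist_sym[OF *(4)]] q by simp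
  then show "family_dist d F G q" by simp
qed

end

theory Submission
  imports Defs
begin

text \<open>
  A Cauchy family on the hat space is pulled back to \<open>X\<close> by collecting, for each member \<open>S\<close> and each
  \<open>e > 0\<close>, the points of \<open>X\<close> that lie within \<open>e\<close> of \<open>S\<close>; since \<open>X\<close> is dense this is a Cauchy
  family on \<open>X\<close>, and its class is the required limit.  For uniqueness, a point \<open>y\<close> of a completion
  \<open>Y\<close> is sent to the class of the traces on \<open>X\<close> of the balls around \<open>y\<close>; completeness of \<open>Y\<close> makes
  this map onto.
\<close>

section \<open>Premetrics and Cauchy families\<close>

lemma premetric_refl:
  assumes "premetric X d" "x \<in> X" "0 \<le> q"
  shows "d x x q"
proof -
  have "d x x 0"
    using assms(1,2) unfolding premetric_def by blast
  then show ?thesis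
    using premetric_mono[OF assms(1,2,2)] assms(3) by blast
qed

lemma premetric_eq:
  assumes "premetric X d" "x \<in> X" "y \<in> X"
  shows "d x y 0 \<longleftrightarrow> x = y"
proof -
  have "\<forall>x\<in>X. \<forall>y\<in>X. d x y 0 \<longleftrightarrow> x = y"
    using assms(1) unfolding premetric_def by (elim conjE)
  then show ?thesis using assms(2,3) by simp
qed

lemma premetric_sym:
  assumes "premetric X d" "x \<in> X" "y \<in> X" "0 \<le> q" "d x y q"
  shows "d y x q"
proof -
  have "\<forall>x\<in>X. \<forall>y\<in>X. \<forall>q\<ge>0. d x y q \<longrightarrow> d y x q"
    using assms(1) unfolding premetric_def by (elim conjE)
  then show ?thesis using assms(2-5) by simp
qed

lemma premetric_triangle:
  assumes "premetric X d" "x \<in> X" "z \<in> X" "y \<in> X" "d x z p" "d z y q" "0 \<le> p" "0 \<le> q" "p + q \<le> r"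
  shows "d x y r"
proof -
  have "d x y (p + q)"
    using assms(1-8) unfolding premetric_def by meson
  then show ?thesis
    using premetric_mono[OF assms(1,2,4)] assms(7-9) by simp
qed

text \<open>The fourth axiom in additive form: estimates proved with an arbitrary positive error
  \<open>e\<close> may drop that error.\<close>

lemma premetric_limit:
  assumes "premetric X d" "x \<in> X" "y \<in> X" "0 \<le> p" "\<And>e. e > 0 \<Longrightarrow> d x y (p + e)"
  shows "d x y p"
proof -
  have "d x y q" if "q > p" for q
    using assms(5)[of "q - p"] that by simp
  then show ?thesis
    using assms(1-4) unfolding premetric_def by blast
qed

lemma diam_le_mono:
  assumes "premetric X d" "S \<subseteq> X" "diam_le d S p" "0 \<le> p" "p \<le> q"
  shows "diam_le d S q"
  unfolding diam_le_def
proof (intro ballI)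
  fix x y assume "x \<in> S" "y \<in> S"
  then have "d x y p" "x \<in> X" "y \<in> X"
    using assms(2,3) unfolding diam_le_def by blast+
  then show "d x y q"
    using premetric_mono[OF assms(1)] assms(4,5) by blast
qed

text \<open>Pairs inside one set are covered by the smaller bound \<open>p\<close>, and symmetry
  supplies the reverse cross pairs. Only distances from \<open>S\<close> to \<open>T\<close>
  therefore remain to be estimated.\<close>

lemma diam_le_UnI:
  assumes X: "premetric X d" and sub: "S \<subseteq> X" "T \<subseteq> X"
    and ST: "diam_le d S p" "diam_le d T p" "0 \<le> p" "p \<le> q"
    and cross: "\<And>x y. x \<in> S \<Longrightarrow> y \<in> T \<Longrightarrow> d x y q"
  shows "diam_le d (S \<union> T) q"
proof -
  have "diam_le d S q" "diam_le d T q"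
    using diam_le_mono[OF X] sub ST by blast+
  moreover have "d y x q" if "x \<in> S" "y \<in> T" for x y
  proof -
    have "x \<in> X" "y \<in> X" "0 \<le> q" using that sub ST(3,4) by auto
    then show ?thesis using premetric_sym[OF X] cross[OF that] by blast
  qed
  ultimately show ?thesis
    using cross unfolding diam_le_def by blast
qed

lemma cauchy_familyD:
  assumes "cauchy_family X d F"
  shows "S \<in> F \<Longrightarrow> S \<subseteq> X"
    and "S \<in> F \<Longrightarrow> T \<in> F \<Longrightarrow> \<exists>x. x \<in> S \<and> x \<in> T"
    and "e > 0 \<Longrightarrow> \<exists>S\<in>F. diam_le d S e"
proof -
  have sub: "F \<subseteq> Pow X" and meet: "\<forall>S\<in>F. \<forall>T\<in>F. S \<inter> T \<noteq> {}"
    and small: "\<forall>e>0. \<exists>S\<in>F. diam_le d S e"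
    using assms unfolding cauchy_family_def by simp_all
  show "S \<in> F \<Longrightarrow> S \<subseteq> X" using sub by blast
  show "S \<in> F \<Longrightarrow> T \<in> F \<Longrightarrow> \<exists>x. x \<in> S \<and> x \<in> T" using meet by blast
  show "e > 0 \<Longrightarrow> \<exists>S\<in>F. diam_le d S e" using small by blast
qed

section \<open>Distances between Cauchy families and to singleton families\<close>

lemma family_dist_mono:
  assumes X: "premetric X d" and F: "cauchy_family X d F" and G: "cauchy_family X d G"
    and dist: "family_dist d F G p" and pq: "0 \<le> p" "p \<le> q"
  shows "family_dist d F G q"
  unfolding family_dist_def
proof (intro allI impI)
  fix e :: rat assume e: "e > 0"
  obtain S T where ST: "S \<in> F" "T \<in> G" "diam_le d S e" "diam_le d T e" "diam_le d (S \<union> T) (p + e)"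
    using dist e unfolding family_dist_def by blast
  have "S \<union> T \<subseteq> X"
    using cauchy_familyD(1)[OF F ST(1)] cauchy_familyD(1)[OF G ST(2)] by blast
  then have "diam_le d (S \<union> T) (q + e)"
    using diam_le_mono[OF X _ ST(5)] pq e by simp
  then show "\<exists>S\<in>F. \<exists>T\<in>G. diam_le d S e \<and> diam_le d T e \<and> diam_le d (S \<union> T) (q + e)"
    using ST by blast
qed

lemma family_dist_limit:
  assumes X: "premetric X d" and F: "cauchy_family X d F" and G: "cauchy_family X d G"
    and dist: "\<And>q. q > p \<Longrightarrow> family_dist d F G q"
  shows "family_dist d F G p"
  unfolding family_dist_def
proof (intro allI impI)
  fix e :: rat assume e: "e > 0"
  \<comment> \<open>The hypothesis is applied at the distance p + e/2 with tolerance e/2, so the two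
    errors add up to the allowed \<open>e\<close>.\<close>
  then have "p + e/2 > p" "e/2 > 0" by simp_all
  then obtain S T where ST: "S \<in> F" "T \<in> G" "diam_le d S (e/2)" "diam_le d T (e/2)"
      "diam_le d (S \<union> T) (p + e/2 + e/2)"
    using dist unfolding family_dist_def by blast
  have "diam_le d S e" "diam_le d T e"
    using diam_le_mono[OF X _ ST(3)] diam_le_mono[OF X _ ST(4)]
      cauchy_familyD(1)[OF F ST(1)] cauchy_familyD(1)[OF G ST(2)] e by simp_all
  then show "\<exists>S\<in>F. \<exists>T\<in>G. diam_le d S e \<and> diam_le d T e \<and> diam_le d (S \<union> T) (p + e)"
    using ST by (auto simp: algebra_simps)
qed

lemma cauchy_family_singleton:
  assumes "premetric X d" "x \<in> X"
  shows "cauchy_family X d {{x}}"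
  using assms(2) premetric_refl[OF assms] by (simp add: cauchy_family_def diam_le_def)

lemma family_dist_singletons:
  assumes X: "premetric X d" and xy: "x \<in> X" "y \<in> X" and q: "0 \<le> q"
  shows "family_dist d {{x}} {{y}} q \<longleftrightarrow> d x y q"
proof
  assume "family_dist d {{x}} {{y}} q"
  then have "d x y (q + e)" if "e > 0" for e
    using that unfolding family_dist_def diam_le_def by simp
  then show "d x y q"
    using premetric_limit[OF X xy q] by blast
next
  assume dist: "d x y q"
  have "diam_le d ({x} \<union> {y}) (q + e)" if "e > 0" for e
  proof (rule diam_le_UnI[OF X, where p = 0])
    show "d u v (q + e)" if "u \<in> {x}" "v \<in> {y}" for u v
      using premetric_mono[OF X xy dist q] that \<open>e > 0\<close> by simp
  qed (use xy q that premetric_refl[OF X] in \<open>simp_all add: diam_le_def\<close>)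
  then show "family_dist d {{x}} {{y}} q"
    using premetric_refl[OF X] xy unfolding family_dist_def by (simp add: diam_le_def)
qed

text \<open>Every small member \<open>T\<close> of the family meets \<open>S\<close> in some
  \<open>t\<close>. The path from \<open>x\<close> through \<open>t\<close> to a point of
  \<open>T\<close> costs at most \<open>q\<close> inside \<open>S\<close> and \<open>e\<close>
  inside \<open>T\<close>. Points of small members thus approximate the whole family, which yields
  density and later the distance estimate to a limit.\<close>

lemma family_dist_singleton_member:
  assumes X: "premetric X d" and F: "cauchy_family X d F"
    and S: "S \<in> F" "x \<in> S" "diam_le d S q" and q: "0 \<le> q"
  shows "family_dist d {{x}} F q"
  unfolding family_dist_def
proof (intro allI impI)
  fix e :: rat assume e: "e > 0"
  obtain T where T: "T \<in> F" "diam_le d T e"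
    using cauchy_familyD(3)[OF F e] by blast
  obtain t where t: "t \<in> S" "t \<in> T"
    using cauchy_familyD(2)[OF F S(1) T(1)] by blast
  have sub: "S \<subseteq> X" "T \<subseteq> X"
    using cauchy_familyD(1)[OF F] S T by blast+
  have x: "diam_le d {x} e"
    using premetric_refl[OF X] S(2) sub e by (auto simp: diam_le_def)
  have "diam_le d ({x} \<union> T) (q + e)"
  proof (rule diam_le_UnI[OF X _ _ x T(2)])
    fix u y assume "u \<in> {x}" "y \<in> T"
    moreover have "d x t q" "d t y e" if "y \<in> T"
      using S T t that unfolding diam_le_def by blast+
    ultimately show "d u y (q + e)"
      using premetric_triangle[OF X, of x t y q e] S t sub q e by auto
  qed (use S sub q e in auto)
  then show "\<exists>S\<in>{{x}}. \<exists>T\<in>F. diam_le d S e \<and> diam_le d T e \<and> diam_le d (S \<union> T) (q + e)"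
    using x T by blast
qed

section \<open>The hat space\<close>

lemma hat_space_iff:
  "A \<in> hat_space X d \<longleftrightarrow> (\<exists>F. cauchy_family X d F \<and> A = family_rel X d `` {F})"
  unfolding hat_space_def quotient_def by auto

lemma family_class_in_hat_space:
  "cauchy_family X d F \<Longrightarrow> family_rel X d `` {F} \<in> hat_space X d"
  unfolding hat_space_iff by blast

lemma family_class_eq_iff:
  assumes "premetric X d" "cauchy_family X d F" "cauchy_family X d G"
  shows "family_rel X d `` {F} = family_rel X d `` {G} \<longleftrightarrow> family_dist d F G 0"
  using eq_equiv_class_iff[OF equiv_family_rel[OF assms(1)]] assms(2,3)
  by (simp add: family_rel_def)

lemma premetric_hat:
  assumes X: "premetric X d"
  shows "premetric (hat_space X d) (hat_dist d)"
proof -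
  let ?c = "\<lambda>F. family_rel X d `` {F}"
  note [simp] = hat_dist_class[OF X]
  \<comment> \<open>Quantifiers over classes become quantifiers over representatives, so each axiom
    reduces to a property of \<open>family_dist\<close>.\<close>
  have all: "(\<forall>A\<in>hat_space X d. P A) \<longleftrightarrow> (\<forall>F. cauchy_family X d F \<longrightarrow> P (?c F))" for P
    unfolding hat_space_def quotient_def by blast
  have "X \<noteq> {}"
    using X unfolding premetric_def by (rule conjunct1)
  then have "hat_space X d \<noteq> {}"
    using family_class_in_hat_space[OF cauchy_family_singleton[OF X]] by blast
  moreover have "hat_dist d (?c F) (?c G) 0 \<longleftrightarrow> ?c F = ?c G"
    if "cauchy_family X d F" "cauchy_family X d G" for F G
    using that family_class_eq_iff[OF X that] by simp
  moreover have "hat_dist d (?c G) (?c F) q"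
    if "cauchy_family X d F" "cauchy_family X d G" "0 \<le> q" "hat_dist d (?c F) (?c G) q" for F G q
    using that family_dist_sym[of d F G q] by simp
  moreover have "hat_dist d (?c F) (?c G) (p + q)"
    if "cauchy_family X d F" "cauchy_family X d G" "cauchy_family X d H" "0 \<le> p" "0 \<le> q"
      "hat_dist d (?c F) (?c H) p \<and> hat_dist d (?c H) (?c G) q" for F G H p q
    using that family_dist_triangle[OF X, of F H G p q] by simp
  moreover have "hat_dist d (?c F) (?c G) p \<longleftrightarrow> (\<forall>q>p. hat_dist d (?c F) (?c G) q)"
    if "cauchy_family X d F" "cauchy_family X d G" "0 \<le> p" for F G p
  proof
    assume "hat_dist d (?c F) (?c G) p"
    then have "family_dist d F G p" using that by simp
    then show "\<forall>q>p. hat_dist d (?c F) (?c G) q"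
      using that family_dist_mono[OF X that(1,2) _ that(3)] by simp
  next
    assume "\<forall>q>p. hat_dist d (?c F) (?c G) q"
    then have "family_dist d F G q" if "q > p" for q
      using that \<open>cauchy_family X d F\<close> \<open>cauchy_family X d G\<close> \<open>0 \<le> p\<close> by simp
    then show "hat_dist d (?c F) (?c G) p"
      using that family_dist_limit[OF X that(1,2)] by simp
  qed
  ultimately show ?thesis
    unfolding premetric_def all by (intro conjI allI impI) assumption+
qed

text \<open>Classes of singleton families always lie in the hat space, so completeness is only
  surjectivity. Two classes agree exactly when their families have distance zero; hence it says that
  every Cauchy family has a limit point. All later uses of completeness go through this
  form.\<close>

lemma complete_premetric_iff:
  assumes X: "premetric X d"
  shows "complete_premetric X d \<longleftrightarrow>
    (\<forall>F. cauchy_family X d F \<longrightarrow> (\<exists>x\<in>X. family_dist d {{x}} F 0))"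
proof -
  have class_in: "hat_emb X d ` X \<subseteq> hat_space X d"
    using family_class_in_hat_space[OF cauchy_family_singleton[OF X]] unfolding hat_emb_def by blast
  have "family_rel X d `` {F} \<in> hat_emb X d ` X \<longleftrightarrow> (\<exists>x\<in>X. family_dist d {{x}} F 0)"
    if "cauchy_family X d F" for F
  proof -
    have "hat_emb X d x = family_rel X d `` {F} \<longleftrightarrow> family_dist d {{x}} F 0" if "x \<in> X" for x
      unfolding hat_emb_def
      using family_class_eq_iff[OF X cauchy_family_singleton[OF X that]] \<open>cauchy_family X d F\<close> by blast
    then show ?thesis by (metis (no_types, lifting) image_iff)
  qed
  then have "hat_space X d \<subseteq> hat_emb X d ` X \<longleftrightarrow>
      (\<forall>F. cauchy_family X d F \<longrightarrow> (\<exists>x\<in>X. family_dist d {{x}} F 0))"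
    unfolding hat_space_def quotient_def by blast
  then show ?thesis
    using X class_in unfolding complete_premetric_def by blast
qed

section \<open>The canonical embedding and its density\<close>

lemma isometric_embedding_hat_emb:
  assumes X: "premetric X d"
  shows "isometric_embedding X d (hat_space X d) (hat_dist d) (hat_emb X d)"
  unfolding isometric_embedding_def hat_emb_def
proof (intro conjI ballI allI impI)
  show "(\<lambda>x. family_rel X d `` {{{x}}}) ` X \<subseteq> hat_space X d"
    using family_class_in_hat_space[OF cauchy_family_singleton[OF X]] by blast
qed (simp add: hat_dist_class[OF X] cauchy_family_singleton[OF X] family_dist_singletons[OF X])

lemma dense_subset_hat_emb:
  assumes X: "premetric X d"
  shows "dense_subset (hat_space X d) (hat_dist d) (hat_emb X d ` X)"
  unfolding dense_subset_def
proof (intro conjI allI impI ballI)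
  show "hat_emb X d ` X \<subseteq> hat_space X d"
    using isometric_embedding_hat_emb[OF X] unfolding isometric_embedding_def by blast
next
  fix e :: rat and A assume e: "e > 0" and "A \<in> hat_space X d"
  then obtain F where F: "cauchy_family X d F" and A: "A = family_rel X d `` {F}"
    by (auto simp: hat_space_iff)
  obtain S where S: "S \<in> F" "diam_le d S e"
    using cauchy_familyD(3)[OF F e] by blast
  obtain x where x: "x \<in> S"
    using cauchy_familyD(2)[OF F S(1) S(1)] by blast
  then have "x \<in> X"
    using cauchy_familyD(1)[OF F S(1)] by blast
  moreover have "hat_dist d (hat_emb X d x) A e"
    unfolding A hat_emb_def
    using hat_dist_class[OF X cauchy_family_singleton[OF X \<open>x \<in> X\<close>] F]
      family_dist_singleton_member[OF X F S(1) x S(2)] e by simp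
  ultimately show "\<exists>z\<in>hat_emb X d ` X. hat_dist d z A e"
    by blast
qed

section \<open>Pulling back Cauchy families along dense embeddings\<close>

text \<open>The members are preimages under \<open>h\<close> of \<open>e\<close>-neighbourhoods of
  members of \<open>G\<close>. Thickening is essential because a member of \<open>G\<close> may miss
  the image of \<open>h\<close>. The radius is chosen independently of the member. For
  \<open>G\<close> equal to \<open>{{y}}\<close> these are the traces on \<open>X\<close> of the
  closed balls around \<open>y\<close>.\<close>

definition trace_family ::
  "'a set \<Rightarrow> ('a \<Rightarrow> 'b) \<Rightarrow> 'b dist_rel \<Rightarrow> 'b set set \<Rightarrow> 'a set set" where
  "trace_family X h dY G = {{x \<in> X. \<exists>y\<in>S. dY (h x) y e} | S e. S \<in> G \<and> e > 0}"

text \<open>For \<open>u\<close> and \<open>v\<close> in the trace with nearby points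
  \<open>y\<close> and \<open>z\<close> of \<open>S\<close>, the chain \<open>h u\<close>,
  \<open>y\<close>, \<open>z\<close>, \<open>h v\<close> has length at most e + p + e. The isometric
  embedding reflects this bound to \<open>X\<close>.\<close>

lemma diam_le_trace:
  assumes Y: "premetric Y dY" and h: "isometric_embedding X d Y dY h"
    and S: "S \<subseteq> Y" "diam_le dY S p" and p: "0 \<le> p" "0 \<le> e"
  shows "diam_le d {x \<in> X. \<exists>y\<in>S. dY (h x) y e} (p + 2 * e)"
  unfolding diam_le_def
proof (intro ballI)
  fix u v
  assume "u \<in> {x \<in> X. \<exists>y\<in>S. dY (h x) y e}" "v \<in> {x \<in> X. \<exists>y\<in>S. dY (h x) y e}"
  then obtain y z where u: "u \<in> X" "y \<in> S" "dY (h u) y e" and v: "v \<in> X" "z \<in> S" "dY (h v) z e"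
    by blast
  have in_Y: "h u \<in> Y" "h v \<in> Y" "y \<in> Y" "z \<in> Y"
    using h S(1) u v unfolding isometric_embedding_def by blast+
  have "dY y z p"
    using S(2) u v unfolding diam_le_def by blast
  then have "dY (h u) z (e + p)"
    using premetric_triangle[OF Y in_Y(1,3,4) u(3)] p by simp
  moreover have "dY z (h v) e"
    using premetric_sym[OF Y in_Y(2,4) p(2) v(3)] .
  ultimately have "dY (h u) (h v) (p + 2 * e)"
    using premetric_triangle[OF Y in_Y(1,4,2)] p by simp
  then show "d u v (p + 2 * e)"
    using h u v p unfolding isometric_embedding_def by simp
qed

lemma cauchy_family_trace:
  assumes Y: "premetric Y dY" and h: "isometric_embedding X d Y dY h"
    and dense: "dense_subset Y dY (h ` X)" and G: "cauchy_family Y dY G"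
  shows "cauchy_family X d (trace_family X h dY G)"
  unfolding cauchy_family_def
proof (intro conjI ballI allI impI)
  show "trace_family X h dY G \<subseteq> Pow X"
    unfolding trace_family_def by blast
next
  fix U V assume "U \<in> trace_family X h dY G" "V \<in> trace_family X h dY G"
  then obtain S e T e' where U: "U = {x \<in> X. \<exists>y\<in>S. dY (h x) y e}" "S \<in> G" "e > 0"
    and V: "V = {x \<in> X. \<exists>y\<in>T. dY (h x) y e'}" "T \<in> G" "e' > 0"
    unfolding trace_family_def by blast
  obtain y where y: "y \<in> S" "y \<in> T"
    using cauchy_familyD(2)[OF G U(2) V(2)] by blast
  then have "y \<in> Y"
    using cauchy_familyD(1)[OF G U(2)] by blast
  \<comment> \<open>By density some \<open>h x\<close> lies within the smaller radius of the common
    point \<open>y\<close>, so \<open>x\<close> belongs to both traces.\<close>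
  moreover have "min e e' > 0" using U V by simp
  ultimately obtain x where x: "x \<in> X" "dY (h x) y (min e e')"
    using dense unfolding dense_subset_def by blast
  have "h x \<in> Y"
    using h x unfolding isometric_embedding_def by blast
  then have "dY (h x) y e" "dY (h x) y e'"
    using premetric_mono[OF Y _ \<open>y \<in> Y\<close> x(2)] U V by simp_all
  then show "U \<inter> V \<noteq> {}"
    using x y U(1) V(1) by blast
next
  fix e :: rat assume e: "e > 0"
  then have e3: "e/3 > 0" by simp
  obtain S where S: "S \<in> G" "diam_le dY S (e/3)"
    using cauchy_familyD(3)[OF G e3] by blast
  have "diam_le d {x \<in> X. \<exists>y\<in>S. dY (h x) y (e/3)} (e/3 + 2 * (e/3))"
    by (rule diam_le_trace[OF Y h cauchy_familyD(1)[OF G S(1)] S(2)]) (use e in simp_all)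
  then have "diam_le d {x \<in> X. \<exists>y\<in>S. dY (h x) y (e/3)} e" by simp
  moreover have "{x \<in> X. \<exists>y\<in>S. dY (h x) y (e/3)} \<in> trace_family X h dY G"
    unfolding trace_family_def using S(1) e3 by blast
  ultimately show "\<exists>U\<in>trace_family X h dY G. diam_le d U e" by blast
qed

section \<open>Completeness of the hat space\<close>

theorem complete_premetric_hat:
  assumes X: "premetric X d"
  shows "complete_premetric (hat_space X d) (hat_dist d)"
  unfolding complete_premetric_iff[OF premetric_hat[OF X]]
proof (intro allI impI)
  let ?Y = "hat_space X d" and ?D = "hat_dist d" and ?h = "hat_emb X d"
  note Y = premetric_hat[OF X]
  note h = isometric_embedding_hat_emb[OF X]
  note dense = dense_subset_hat_emb[OF X]
  fix G assume G: "cauchy_family ?Y ?D G"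
  define F where "F = trace_family X ?h ?D G"
  have F: "cauchy_family X d F"
    unfolding F_def by (rule cauchy_family_trace[OF Y h dense G])
  define B where "B = family_rel X d `` {F}"
  have B: "B \<in> ?Y"
    unfolding B_def by (rule family_class_in_hat_space[OF F])
  have "family_dist ?D {{B}} G 0"
    unfolding family_dist_def
  proof (intro allI impI)
    fix e :: rat assume e: "e > 0"
    \<comment> \<open>A member of diameter e/4 thickened by e/4 has a trace of diameter at most
      3e/4. The remaining quarter pays for the passage from an embedded point to a point of the
      member.\<close>
    then have e4: "e/4 > 0" by simp
    obtain S where S: "S \<in> G" "diam_le ?D S (e/4)"
      using cauchy_familyD(3)[OF G e4] by blast
    have sub: "S \<subseteq> ?Y"
      using cauchy_familyD(1)[OF G S(1)] .
    define U where "U = {x \<in> X. \<exists>A\<in>S. ?D (?h x) A (e/4)}"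
    have U: "U \<in> F"
      unfolding U_def F_def trace_family_def using S(1) e4 by blast
    have "diam_le d U (e/4 + 2 * (e/4))"
      unfolding U_def by (rule diam_le_trace[OF Y h sub S(2)]) (use e in simp_all)
    then have diam_U: "diam_le d U (3 * (e/4))" by simp
    \<comment> \<open>An embedded point \<open>?h x\<close> near \<open>A\<close> links the two:
      \<open>x\<close> lies in the member \<open>U\<close> of \<open>F\<close>, so
      \<open>?h x\<close> is within 3e/4 of the class \<open>B\<close> of \<open>F\<close>, and it
      is within e/4 of \<open>A\<close>.\<close>
    have close: "?D B A e" if A: "A \<in> S" for A
    proof -
      have "A \<in> ?Y" using A sub by blast
      then obtain x where x: "x \<in> X" "?D (?h x) A (e/4)"
        using dense e4 unfolding dense_subset_def by blast
      have hx: "?h x \<in> ?Y"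
        using h x unfolding isometric_embedding_def by blast
      have "x \<in> U" unfolding U_def using x A by blast
      then have "family_dist d {{x}} F (3 * (e/4))"
        using family_dist_singleton_member[OF X F U _ diam_U] e by simp
      then have "?D (?h x) B (3 * (e/4))"
        unfolding B_def hat_emb_def
        using hat_dist_class[OF X cauchy_family_singleton[OF X x(1)] F] e by simp
      then have "?D B (?h x) (3 * (e/4))"
        using premetric_sym[OF Y hx B] e by simp
      then show ?thesis
        using premetric_triangle[OF Y B hx \<open>A \<in> ?Y\<close> _ x(2)] e by simp
    qed
    have diam: "diam_le ?D {B} e" "diam_le ?D S e"
      using premetric_refl[OF Y B] diam_le_mono[OF Y sub S(2)] e by (simp_all add: diam_le_def)
    then have "diam_le ?D ({B} \<union> S) e"
      using diam_le_UnI[OF Y _ sub diam, of e] B close e by simp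
    then show "\<exists>T\<in>{{B}}. \<exists>S\<in>G. diam_le ?D T e \<and> diam_le ?D S e \<and> diam_le ?D (T \<union> S) (0 + e)"
      using S(1) diam by auto
  qed
  then show "\<exists>B\<in>?Y. family_dist ?D {{B}} G 0"
    using B by blast
qed

section \<open>Uniqueness of the completion\<close>

text \<open>This carries a Cauchy family of \<open>X\<close> to \<open>Y\<close>, where completeness
  can supply its limit. Isometric embeddings preserve diameter bounds, and common points map to
  common points.\<close>

lemma cauchy_family_image:
  assumes h: "isometric_embedding X d Y dY h" and F: "cauchy_family X d F"
  shows "cauchy_family Y dY ((`) h ` F)"
  unfolding cauchy_family_def
proof (intro conjI ballI allI impI)
  show "(`) h ` F \<subseteq> Pow Y"
    using h cauchy_familyD(1)[OF F] unfolding isometric_embedding_def by blast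
next
  fix S T assume "S \<in> (`) h ` F" "T \<in> (`) h ` F"
  then show "S \<inter> T \<noteq> {}"
    using cauchy_familyD(2)[OF F] by blast
next
  fix e :: rat assume e: "e > 0"
  then obtain S where S: "S \<in> F" "diam_le d S e"
    using cauchy_familyD(3)[OF F] by blast
  have "diam_le dY (h ` S) e"
    unfolding diam_le_def
  proof (intro ballI)
    fix u v assume "u \<in> h ` S" "v \<in> h ` S"
    then obtain x y where xy: "x \<in> S" "y \<in> S" "u = h x" "v = h y" by blast
    then have "d x y e" "x \<in> X" "y \<in> X"
      using S cauchy_familyD(1)[OF F S(1)] unfolding diam_le_def by blast+
    then show "dY u v e"
      using h e xy unfolding isometric_embedding_def by simp
  qed
  then show "\<exists>S\<in>(`) h ` F. diam_le dY S e"
    using S(1) by blast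
qed

text \<open>Passing from points of \<open>Y\<close> to their trace families preserves and reflects
  distance bounds, so the induced map into the hat space is an isometric embedding.\<close>

lemma family_dist_trace:
  assumes X: "premetric X d" and Y: "premetric Y dY" and h: "isometric_embedding X d Y dY h"
    and dense: "dense_subset Y dY (h ` X)" and y: "y \<in> Y" "y' \<in> Y" and q: "0 \<le> q"
  shows "family_dist d (trace_family X h dY {{y}}) (trace_family X h dY {{y'}}) q \<longleftrightarrow> dY y y' q"
    (is "family_dist d (?F y) (?F y') q \<longleftrightarrow> _")
proof
  let ?ball = "\<lambda>y e. {x \<in> X. dY (h x) y e}"
  have ball: "?ball y e \<in> ?F y" if "e > 0" for y e
    using that unfolding trace_family_def by auto
  note cauchy = cauchy_family_trace[OF Y h dense cauchy_family_singleton[OF Y]]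
  have hX: "h x \<in> Y" if "x \<in> X" for x
    using h that unfolding isometric_embedding_def by blast
  {
    assume "family_dist d (?F y) (?F y') q"
    show "dY y y' q"
    proof (rule premetric_limit[OF Y y q])
      fix e :: rat assume e: "e > 0"
      \<comment> \<open>The chain \<open>y\<close>, \<open>h s\<close>, \<open>h t\<close>,
        \<open>y'\<close> will cost e/3, q + e/3 and e/3.\<close>
      then have e3: "e/3 > 0" by simp
      obtain S T where ST: "S \<in> ?F y" "T \<in> ?F y'" "diam_le d (S \<union> T) (q + e/3)"
        using \<open>family_dist d (?F y) (?F y') q\<close> e3 unfolding family_dist_def by blast
      \<comment> \<open>The radii of \<open>S\<close> and \<open>T\<close> are not controlled, but both sets meet the small balls.\<close>
      obtain s where s: "s \<in> S" "s \<in> ?ball y (e/3)"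
        using cauchy_familyD(2)[OF cauchy[OF y(1)] ST(1) ball[OF e3]] by blast
      obtain t where t: "t \<in> T" "t \<in> ?ball y' (e/3)"
        using cauchy_familyD(2)[OF cauchy[OF y(2)] ST(2) ball[OF e3]] by blast
      have st: "h s \<in> Y" "h t \<in> Y" "dY (h s) y (e/3)" "dY (h t) y' (e/3)"
        using s t hX by auto
      have "d s t (q + e/3)"
        using ST(3) s t unfolding diam_le_def by blast
      then have "dY (h s) (h t) (q + e/3)"
        using h s t q e unfolding isometric_embedding_def by simp
      moreover have "dY y (h s) (e/3)"
        using premetric_sym[OF Y st(1) y(1) _ st(3)] e by simp
      ultimately have "dY y (h t) (q + 2 * (e/3))"
        using premetric_triangle[OF Y y(1) st(1,2)] q e by simp
      then show "dY y y' (q + e)"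
        using premetric_triangle[OF Y y(1) st(2) y(2) _ st(4)] q e by simp
    qed
  next
    assume dist: "dY y y' q"
    show "family_dist d (?F y) (?F y') q"
      unfolding family_dist_def
    proof (intro allI impI)
      fix e :: rat assume e: "e > 0"
      \<comment> \<open>Radius e/2 meets both demands: each ball trace has diameter at most
        \<open>e\<close>, and the chain \<open>h u\<close>, \<open>y\<close>, \<open>y'\<close>,
        \<open>h v\<close> has length at most e/2 + q + e/2.\<close>
      then have e2: "e/2 > 0" by simp
      have diam: "diam_le d (?ball z (e/2)) e" if "z \<in> Y" for z
        using diam_le_trace[OF Y h, of "{z}" 0 "e/2"] that e premetric_refl[OF Y that]
        by (simp add: diam_le_def)
      have cross: "d u v (q + e)" if "u \<in> ?ball y (e/2)" "v \<in> ?ball y' (e/2)" for u v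
      proof -
        have uv: "h u \<in> Y" "h v \<in> Y" "dY (h u) y (e/2)" "dY (h v) y' (e/2)"
          using that hX by auto
        have "dY y' (h v) (e/2)"
          using premetric_sym[OF Y uv(2) y(2) _ uv(4)] e by simp
        moreover have "dY (h u) y' (q + e/2)"
          using premetric_triangle[OF Y uv(1) y uv(3) dist] q e by simp
        ultimately have "dY (h u) (h v) (q + e)"
          using premetric_triangle[OF Y uv(1) y(2) uv(2)] q e by simp
        then show ?thesis
          using h that q e unfolding isometric_embedding_def by simp
      qed
      have "diam_le d (?ball y (e/2) \<union> ?ball y' (e/2)) (q + e)"
        by (rule diam_le_UnI[OF X _ _ diam[OF y(1)] diam[OF y(2)] _ _ cross]) (use q e in auto)
      then show "\<exists>S\<in>?F y. \<exists>T\<in>?F y'. diam_le d S e \<and> diam_le d T e \<and> diam_le d (S \<union> T) (q + e)"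
        using ball[OF e2] diam y by blast
    qed
  }
qed

text \<open>If the image of \<open>F\<close> converges to \<open>y\<close>, then \<open>F\<close> is
  equivalent to the trace family of \<open>y\<close>. This identifies the preimage of a given class
  in the surjectivity argument.\<close>

lemma family_dist_trace_limit:
  assumes X: "premetric X d" and Y: "premetric Y dY" and h: "isometric_embedding X d Y dY h"
    and F: "cauchy_family X d F" and y: "y \<in> Y" "family_dist dY {{y}} ((`) h ` F) 0"
  shows "family_dist d (trace_family X h dY {{y}}) F 0"
  unfolding family_dist_def
proof (intro allI impI)
  fix e :: rat assume e: "e > 0"
  then have e2: "e/2 > 0" by simp
  let ?B = "{x \<in> X. dY (h x) y (e/2)}"
  obtain S where S: "S \<in> F" "diam_le dY ({y} \<union> h ` S) (0 + e/2)"
    using y(2) e2 unfolding family_dist_def by blast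
  \<comment> \<open>The bound on the joint diameter with \<open>y\<close> puts \<open>S\<close>
    inside the ball trace. The union is then \<open>?B\<close> itself, and one diameter estimate
    settles all three conditions.\<close>
  have sub: "S \<subseteq> ?B"
    using S cauchy_familyD(1)[OF F S(1)] unfolding diam_le_def by auto
  have diam: "diam_le d ?B e"
    using diam_le_trace[OF Y h, of "{y}" 0 "e/2"] y(1) e premetric_refl[OF Y y(1)]
    by (simp add: diam_le_def)
  moreover have "diam_le d S e"
    using diam sub unfolding diam_le_def by blast
  moreover have "?B \<union> S = ?B" using sub by blast
  moreover have "?B \<in> trace_family X h dY {{y}}"
    unfolding trace_family_def using e2 by auto
  ultimately show "\<exists>T\<in>trace_family X h dY {{y}}. \<exists>S\<in>F.
      diam_le d T e \<and> diam_le d S e \<and> diam_le d (T \<union> S) (0 + e)"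
    using S(1) by (metis add_0)
qed

theorem completion_isometric_hat:
  assumes X: "premetric X d" and Y: "complete_premetric Y dY"
    and h: "isometric_embedding X d Y dY h" and dense: "dense_subset Y dY (h ` X)"
  shows "\<exists>g. isometry Y dY (hat_space X d) (hat_dist d) g \<and> bij_betw g Y (hat_space X d)"
proof -
  have pY: "premetric Y dY"
    using Y unfolding complete_premetric_def by blast
  define g where "g y = family_rel X d `` {trace_family X h dY {{y}}}" for y
  have cauchy: "cauchy_family X d (trace_family X h dY {{y}})" if "y \<in> Y" for y
    using cauchy_family_trace[OF pY h dense cauchy_family_singleton[OF pY that]] .
  have g_hat: "g ` Y \<subseteq> hat_space X d"
    using family_class_in_hat_space[OF cauchy] unfolding g_def by blast
  have dist: "hat_dist d (g y) (g y') q \<longleftrightarrow> dY y y' q" if "y \<in> Y" "y' \<in> Y" "0 \<le> q" for y y' q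
    unfolding g_def
    using hat_dist_class[OF X cauchy cauchy] family_dist_trace[OF X pY h dense] that by blast
  have "hat_space X d \<subseteq> g ` Y"
  proof
    fix A assume "A \<in> hat_space X d"
    then obtain F where F: "cauchy_family X d F" and A: "A = family_rel X d `` {F}"
      by (auto simp: hat_space_iff)
    \<comment> \<open>Completeness of \<open>Y\<close> enters here: the image of a representative
      \<open>F\<close> has a limit \<open>y\<close>, and this \<open>y\<close> is mapped to the
      class of \<open>F\<close>.\<close>
    obtain y where y: "y \<in> Y" "family_dist dY {{y}} ((`) h ` F) 0"
      using Y cauchy_family_image[OF h F] unfolding complete_premetric_iff[OF pY] by blast
    have "g y = A"
      unfolding g_def A
      using family_class_eq_iff[OF X cauchy[OF y(1)] F] family_dist_trace_limit[OF X pY h F y] by blast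
    then show "A \<in> g ` Y" using y(1) by blast
  qed
  then have onto: "g ` Y = hat_space X d"
    using g_hat by blast
  \<comment> \<open>Equal images have distance zero; \<open>dist\<close> at q = 0 transfers this to
    \<open>Y\<close>, where points at distance zero coincide.\<close>
  have "inj_on g Y"
  proof (rule inj_onI)
    fix y y' assume y: "y \<in> Y" "y' \<in> Y" "g y = g y'"
    have "g y \<in> hat_space X d" "g y' \<in> hat_space X d" using g_hat y by blast+
    then show "y = y'"
      using dist[OF y(1,2), of 0] premetric_eq[OF premetric_hat[OF X]] premetric_eq[OF pY y(1,2)] y(3)
      by simp
  qed
  then show ?thesis
    using onto dist unfolding isometry_def isometric_embedding_def bij_betw_def by blast
qed

text \<open>The existential over completions names the carrier type of the hat space, which is the
  witness. The uniqueness clause lets the competing completion live in an arbitrary type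
  \<open>'b\<close>.\<close>

theorem theorem3p3:
  fixes X :: "'a set" and d :: "'a dist_rel"
  assumes "premetric X d"
  shows "complete_premetric (hat_space X d) (hat_dist d) \<and>
    (\<exists>(Y :: 'a set set set set) dY h. is_completion X d Y dY h) \<and>
    (\<forall>(Y :: 'b set) dY h.
       complete_premetric Y dY \<and> isometric_embedding X d Y dY h \<and> dense_subset Y dY (h ` X) \<longrightarrow>
       (\<exists>g. isometry Y dY (hat_space X d) (hat_dist d) g \<and> bij_betw g Y (hat_space X d)))"
proof (intro conjI allI impI)
  show complete: "complete_premetric (hat_space X d) (hat_dist d)"
    by (rule complete_premetric_hat[OF assms])
  show "\<exists>(Y :: 'a set set set set) dY h. is_completion X d Y dY h"
    using complete isometric_embedding_hat_emb[OF assms] dense_subset_hat_emb[OF assms]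
    unfolding is_completion_def by blast
next
  fix Y :: "'b set" and dY h
  assume "complete_premetric Y dY \<and> isometric_embedding X d Y dY h \<and> dense_subset Y dY (h ` X)"
  then show "\<exists>g. isometry Y dY (hat_space X d) (hat_dist d) g \<and> bij_betw g Y (hat_space X d)"
    using completion_isometric_hat[OF assms] by blast
qed

end
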